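(* In the setting described in the context, let $\kappa$ be the measure on $\mathcal Z\times\mathbb X$ $$\kappa(B)=\int\frac{\mathbf 1((z,x)\in B)}{\sigma(z)}\,m(z,x)\,d\gamma(x)\,d\upsilon(z),\qquad B\subseteq\mathcal Z\times\mathbb X\ \text{Borel},$$ and let $$\mathbf R\phi(z,x)=\frac{\sigma(z)}{m(z,x)}\,[\mathtt A^{(x)}f_{\phi,x}](z)+\alpha(z)\,[\mathtt L^{(z)}g_{\phi,z}](x),$$ where $f_{\phi,x}:z\mapsto\phi(z,x)$ and $g_{\phi,z}:x\mapsto\phi(z,x)$. (I) $\kappa$ and $\mathbf R$ obey the weak invariance equation in the following sense: the integral $\int_{\mathcal Z\times\mathbb X}(\mathbf R\phi)\,d\kappa$ exists and equals $0$ for every admissible function $\phi$ (see context) for which $$\int_{\mathbb X}\Big\{\int_{\mathcal Z}\big|[\mathtt A^{(x)}f_{\phi,x}](z)\big|\,d\upsilon(z)\Big\}d\gamma(x)<\infty,\qquad \int_{\mathcal Z}[\mathtt A^{(x)}f_{\phi,x}](z)\,d\upsilon(z)=0\ \text{ for }\gamma\text{-a.a. }x\in\mathbb X,$$ and $$\int_{\mathcal Z}\frac{\alpha(z)}{\sigma(z)}\Big\{\int_{\mathbb X}\big|[\mathtt L^{(z)}g_{\phi,z}](x)\big|\,d\nu^{(z)}(x)\Big\}d\upsilon(z)<\infty,\qquad \int_{\mathbb X}[\mathtt L^{(z)}g_{\phi,z}](x)\,d\nu^{(z)}(x)=0\ \text{ for }\upsilon\text{-a.a. }z\in\mathcal Z.$$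 (II) If $\Xi=\kappa(\mathcal Z\times\mathbb X)<\infty$, then $\pi(B)=\kappa(B)/\Xi$ is a probability distribution on $\mathcal Z\times\mathbb X$ with $\int_{\mathcal Z\times\mathbb X}(\mathbf R\phi)\,d\pi=0$ for all $\phi$ as in (I).
   Context: $\mathcal Z$ and $\mathbb X$ are locally compact Polish spaces; $\upsilon$ (on $\mathcal Z$), $\gamma$ and $\nu^{(z)}$, $z\in\mathcal Z$ (on $\mathbb X$) are Borel measures, countably additive and finite on compact sets ($\upsilon,\gamma$ nonzero). Each $\nu^{(z)}$ is absolutely continuous with respect to $\gamma$ with density $m(z,x)=\frac{d\nu^{(z)}}{d\gamma}(x)$, jointly measurable, and $m(z,x)>0$ for $(\upsilon\times\gamma)$-a.a. $(z,x)$. For every $z\in\mathcal Z$, $\mathtt L^{(z)}$ is a closed linear operator with domain $\mathrm D(\mathtt L^{(z)})$ dense in $\mathrm C_{\mathrm b}(\mathbb X)$ (bounded continuous functions), generating a Feller Markov process on $\mathbb X$, and for every $g$ in a core of $\mathtt L^{(z)}$ the integral $\int_{\mathbb X}(\mathtt L^{(z)}g)\,d\nu^{(z)}$ exists and equals $0$. For every $x\in\mathbb X$, $\mathtt A^{(x)}$ is a closed linear operator with domain $\mathrm D(\mathtt A^{(x)})$ dense in $\mathrm C_{\mathrm b}(\mathcal Z)$, generating a Feller Markov process on $\mathcal Z$, and for every $f$ in a core of $\mathtt A^{(x)}$ the integral $\int_{\mathcal Z}(\mathtt A^{(x)}f)\,d\upsilon$ exists and equals $0$ (the same $\upsilon$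 for all $x$). $\sigma,\alpha:\mathcal Z\to\mathbb R$ are measurable time-scale functions with $\sigma(z)>0$ for $\upsilon$-a.a. $z$ and $\alpha(z)>0$. Admissible functions: $\phi:\mathcal Z\times\mathbb X\to\mathbb R$ in $\mathrm C_{\mathrm b}(\mathcal Z)\otimes\mathrm C_{\mathrm b}(\mathbb X)$ (Banach tensor product with a fixed reasonable cross-norm, whose elements are regarded as bounded continuous functions on $\mathcal Z\times\mathbb X$) such that $g_{\phi,z}\in\mathrm D(\mathtt L^{(z)})$ for all $z\in\mathcal Z$ and $f_{\phi,x}\in\mathrm D(\mathtt A^{(x)})$ for all $x\in\mathbb X$; it is understood that $(z,x)\mapsto[\mathtt A^{(x)}f_{\phi,x}](z)$ and $(z,x)\mapsto[\mathtt L^{(z)}g_{\phi,z}](x)$ are measurable. *)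

theory Defs
  imports "HOL-Probability.Probability"
begin

definition locally_finite_borel_measure :: "'a::topological_space measure \<Rightarrow> bool" where
  "locally_finite_borel_measure M \<longleftrightarrow>
     sets M = sets borel \<and> (\<forall>K. compact K \<longrightarrow> emeasure M K < \<infinity>)"


section \<open>Closed operators and cores\<close>

text \<open>A partially defined operator is given by its domain \<open>D\<close> and a function \<open>T\<close>, whose values
  off \<open>D\<close> are irrelevant.\<close>

definition op_graph :: "'a set \<Rightarrow> ('a \<Rightarrow> 'b) \<Rightarrow> ('a \<times> 'b) set" where
  "op_graph D T = (\<lambda>f. (f, T f)) ` D"

definition closed_linear_operator ::
    "'a::real_normed_vector set \<Rightarrow> ('a \<Rightarrow> 'a) \<Rightarrow> bool" where
  "closed_linear_operator D T \<longleftrightarrow>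
     subspace D \<and>
     (\<forall>f\<in>D. \<forall>g\<in>D. T (f + g) = T f + T g) \<and>
     (\<forall>c. \<forall>f\<in>D. T (c *\<^sub>R f) = c *\<^sub>R T f) \<and>
     closed (op_graph D T)"

definition is_core ::
    "'a::real_normed_vector set \<Rightarrow> 'a set \<Rightarrow> ('a \<Rightarrow> 'a) \<Rightarrow> bool" where
  "is_core C D T \<longleftrightarrow> subspace C \<and> C \<subseteq> D \<and> closure (op_graph C T) = op_graph D T"


section \<open>Feller Markov processes and their generators\<close>

definition transition_operator ::
    "(real \<Rightarrow> 'a \<Rightarrow> 'a measure) \<Rightarrow> real \<Rightarrow> ('a::topological_space \<Rightarrow>\<^sub>C real) \<Rightarrow> ('a \<Rightarrow>\<^sub>C real)" where
  "transition_operator P t f = Bcontfun (\<lambda>x. \<integral>y. apply_bcontfun f y \<partial>P t x)"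

text \<open>\<open>P t x\<close> is the law at time \<open>t \<ge> 0\<close> of the process started at \<open>x\<close>. The fourth condition (the
  Feller property) makes \<^const>\<open>transition_operator\<close> well behaved, \<^const>\<open>Bcontfun\<close> being
  unspecified outside \<^const>\<open>bcontfun\<close>; strong continuity is with respect to the sup norm.\<close>

definition feller_transition_function ::
    "(real \<Rightarrow> 'a::polish_space \<Rightarrow> 'a measure) \<Rightarrow> bool" where
  "feller_transition_function P \<longleftrightarrow>
     (\<forall>t\<ge>0. P t \<in> borel \<rightarrow>\<^sub>M prob_algebra borel) \<and>
     (\<forall>x. P 0 x = return borel x) \<and>
     (\<forall>s\<ge>0. \<forall>t\<ge>0. \<forall>x. P (s + t) x = P s x \<bind> P t) \<and>
     (\<forall>t\<ge>0. \<forall>f :: 'a \<Rightarrow>\<^sub>C real. (\<lambda>x. \<integral>y. apply_bcontfun f y \<partial>P t x) \<in> bcontfun) \<and>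
     (\<forall>f :: 'a \<Rightarrow>\<^sub>C real. ((\<lambda>t. transition_operator P t f) \<longlongrightarrow> f) (at_right 0))"

text \<open>The process is realised on the canonical path space: \<open>Q x\<close> is the law of the process
  started at \<open>x\<close>. The events \<open>E\<close> below are exactly those of the natural filtration at
  time \<open>s\<close>, so the last condition is the Markov property
  \<open>\<P>\<^sub>x(X\<^sub>s\<^sub>+\<^sub>t \<in> B | \<F>\<^sub>s) = P\<^sub>t(X\<^sub>s, B)\<close>.\<close>

definition markov_process_laws ::
    "(real \<Rightarrow> 'a::polish_space \<Rightarrow> 'a measure) \<Rightarrow> ('a \<Rightarrow> (real \<Rightarrow> 'a) measure) \<Rightarrow> bool" where
  "markov_process_laws P Q \<longleftrightarrow>
     (\<forall>x. prob_space (Q x) \<and> sets (Q x) = sets (Pi\<^sub>M {0..} (\<lambda>_. borel)) \<and>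
       (AE \<omega> in Q x. \<omega> 0 = x) \<and>
       (\<forall>s\<ge>0. \<forall>t\<ge>0. \<forall>B \<in> sets borel. \<forall>F \<in> sets (Pi\<^sub>M {0..s} (\<lambda>_. borel :: 'a measure)).
          let E = (\<lambda>\<omega>. restrict \<omega> {0..s}) -` F \<inter> space (Q x) in
          emeasure (Q x) (E \<inter> {\<omega>. \<omega> (s + t) \<in> B}) =
            (\<integral>\<^sup>+\<omega>\<in>E. emeasure (P t (\<omega> s)) B \<partial>Q x)))"

definition generates_feller_markov_process ::
    "('a::polish_space \<Rightarrow>\<^sub>C real) set \<Rightarrow> (('a \<Rightarrow>\<^sub>C real) \<Rightarrow> ('a \<Rightarrow>\<^sub>C real)) \<Rightarrow> bool" where
  "generates_feller_markov_process D T \<longleftrightarrow>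
     (\<exists>P Q. feller_transition_function P \<and> markov_process_laws P Q \<and>
        (\<forall>f g. ((\<lambda>t. (1 / t) *\<^sub>R (transition_operator P t f - f)) \<longlongrightarrow> g) (at_right 0)
           \<longleftrightarrow> f \<in> D \<and> g = T f))"

definition feller_generator ::
    "('a::polish_space \<Rightarrow>\<^sub>C real) set \<Rightarrow> (('a \<Rightarrow>\<^sub>C real) \<Rightarrow> ('a \<Rightarrow>\<^sub>C real)) \<Rightarrow> bool" where
  "feller_generator D T \<longleftrightarrow>
     closed_linear_operator D T \<and> closure D = UNIV \<and> generates_feller_markov_process D T"

text \<open>``The integral exists and equals 0'' is rendered by \<^const>\<open>has_bochner_integral\<close>, i.e. by
  Lebesgue integrability together with the value.\<close>

definition core_invariant ::
    "'a::polish_space measure \<Rightarrow> ('a \<Rightarrow>\<^sub>C real) set \<Rightarrow> (('a \<Rightarrow>\<^sub>C real) \<Rightarrow> ('a \<Rightarrow>\<^sub>C real)) \<Rightarrow> bool" where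
  "core_invariant M D T \<longleftrightarrow>
     (\<exists>C. is_core C D T \<and> (\<forall>f\<in>C. has_bochner_integral M (apply_bcontfun (T f)) 0))"


section \<open>Tensor products of spaces of bounded continuous functions\<close>

definition elementary_tensor ::
    "('z::topological_space \<Rightarrow>\<^sub>C real) \<Rightarrow> ('x::topological_space \<Rightarrow>\<^sub>C real) \<Rightarrow> (('z \<times> 'x) \<Rightarrow>\<^sub>C real)" where
  "elementary_tensor f g = Bcontfun (\<lambda>(z, x). apply_bcontfun f z * apply_bcontfun g x)"

text \<open>The algebraic tensor product embeds into the bounded continuous functions on the product;
  it is identified with its image.\<close>

definition algebraic_tensor :: "(('z::topological_space \<times> 'x::topological_space) \<Rightarrow>\<^sub>C real) set" where
  "algebraic_tensor = span (range (\<lambda>(f, g). elementary_tensor f g))"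

text \<open>The last condition says that, for bounded functionals \<open>F\<close> and \<open>G\<close>, the functional \<open>F \<otimes> G\<close> is
  bounded by \<open>\<parallel>F\<parallel> \<parallel>G\<parallel>\<close> with respect to \<open>N\<close>.\<close>

definition reasonable_cross_norm ::
    "((('z::topological_space \<times> 'x::topological_space) \<Rightarrow>\<^sub>C real) \<Rightarrow> real) \<Rightarrow> bool" where
  "reasonable_cross_norm N \<longleftrightarrow>
     (\<forall>u\<in>algebraic_tensor. 0 \<le> N u \<and> (N u = 0 \<longleftrightarrow> u = 0)) \<and>
     (\<forall>u\<in>algebraic_tensor. \<forall>v\<in>algebraic_tensor. N (u + v) \<le> N u + N v) \<and>
     (\<forall>c. \<forall>u\<in>algebraic_tensor. N (c *\<^sub>R u) = \<bar>c\<bar> * N u) \<and>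
     (\<forall>f g. N (elementary_tensor f g) \<le> norm f * norm g) \<and>
     (\<forall>(F :: ('z \<Rightarrow>\<^sub>C real) \<Rightarrow>\<^sub>L real) (G :: ('x \<Rightarrow>\<^sub>C real) \<Rightarrow>\<^sub>L real) f g (n::nat).
        \<bar>\<Sum>i<n. blinfun_apply F (f i) * blinfun_apply G (g i)\<bar>
          \<le> norm F * norm G * N (\<Sum>i<n. elementary_tensor (f i) (g i)))"

text \<open>A reasonable cross-norm dominates the sup norm, so an \<open>N\<close>-Cauchy sequence in the algebraic
  tensor product converges uniformly; its limit is the function which the corresponding element of
  the completion is regarded as.\<close>

definition banach_tensor ::
    "((('z::topological_space \<times> 'x::topological_space) \<Rightarrow>\<^sub>C real) \<Rightarrow> real) \<Rightarrow> (('z \<times> 'x) \<Rightarrow>\<^sub>C real) set" where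
  "banach_tensor N = {\<phi>. \<exists>u. (\<forall>n. u n \<in> algebraic_tensor) \<and>
     (\<forall>e>0. \<exists>k. \<forall>i\<ge>k. \<forall>j\<ge>k. N (u i - u j) < e) \<and> u \<longlonglongrightarrow> \<phi>}"


section \<open>The combined operator and its candidate invariant measure\<close>

definition z_section ::
    "(('z::topological_space \<times> 'x::topological_space) \<Rightarrow>\<^sub>C real) \<Rightarrow> 'x \<Rightarrow> ('z \<Rightarrow>\<^sub>C real)" where
  "z_section \<phi> x = Bcontfun (\<lambda>z. apply_bcontfun \<phi> (z, x))"

definition x_section ::
    "(('z::topological_space \<times> 'x::topological_space) \<Rightarrow>\<^sub>C real) \<Rightarrow> 'z \<Rightarrow> ('x \<Rightarrow>\<^sub>C real)" where
  "x_section \<phi> z = Bcontfun (\<lambda>x. apply_bcontfun \<phi> (z, x))"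

text \<open>\<^const>\<open>density\<close> of a product measure is the iterated integral in the definition of \<open>\<kappa>\<close>, see
  \<open>emeasure_kappa\<close> below; the values of the density on the null set \<open>\<sigma> \<le> 0\<close> do not matter.\<close>

definition kappa ::
    "'z measure \<Rightarrow> 'x measure \<Rightarrow> ('z \<Rightarrow> 'x \<Rightarrow> real) \<Rightarrow> ('z \<Rightarrow> real) \<Rightarrow> ('z \<times> 'x) measure" where
  "kappa \<upsilon> \<gamma> m \<sigma> = density (\<upsilon> \<Otimes>\<^sub>M \<gamma>) (\<lambda>(z, x). ennreal (m z x / \<sigma> z))"

lemma emeasure_kappa:
  fixes \<upsilon> :: "'z::polish_space measure" and \<gamma> :: "'x::polish_space measure"
  assumes "sigma_finite_measure \<gamma>" and s: "sets \<upsilon> = sets borel" "sets \<gamma> = sets borel"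
    and "(\<lambda>(z, x). m z x) \<in> borel_measurable borel" "\<sigma> \<in> borel_measurable borel"
    and "B \<in> sets borel"
  shows "emeasure (kappa \<upsilon> \<gamma> m \<sigma>) B =
    (\<integral>\<^sup>+z. (\<integral>\<^sup>+x. ennreal (m z x / \<sigma> z) * indicator B (z, x) \<partial>\<gamma>) \<partial>\<upsilon>)"
proof -
  interpret sigma_finite_measure \<gamma> by fact
  have p: "sets (\<upsilon> \<Otimes>\<^sub>M \<gamma>) = sets (borel :: ('z \<times> 'x) measure)"
    using s by (simp add: borel_prod[symmetric] cong: sets_pair_measure_cong)
  have "(\<lambda>p. case p of (z, x) \<Rightarrow> m z x) \<in> borel_measurable (\<upsilon> \<Otimes>\<^sub>M \<gamma>)"
    using assms(4) by (simp add: measurable_cong_sets[OF p refl])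
  moreover have "\<sigma> \<in> borel_measurable \<upsilon>"
    using assms(5) by (simp add: measurable_cong_sets[OF s(1) refl])
  ultimately have d: "(\<lambda>(z, x). ennreal (m z x / \<sigma> z)) \<in> borel_measurable (\<upsilon> \<Otimes>\<^sub>M \<gamma>)"
    unfolding case_prod_beta by measurable
  have B: "B \<in> sets (\<upsilon> \<Otimes>\<^sub>M \<gamma>)" using p assms(6) by simp
  have "emeasure (kappa \<upsilon> \<gamma> m \<sigma>) B =
      (\<integral>\<^sup>+p. (case p of (z, x) \<Rightarrow> ennreal (m z x / \<sigma> z)) * indicator B p \<partial>(\<upsilon> \<Otimes>\<^sub>M \<gamma>))"
    unfolding kappa_def by (rule emeasure_density[OF d B])
  also have "\<dots> = (\<integral>\<^sup>+z. (\<integral>\<^sup>+x. ennreal (m z x / \<sigma> z) * indicator B (z, x) \<partial>\<gamma>) \<partial>\<upsilon>)"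
    using d B by (subst nn_integral_fst[symmetric]) (auto intro!: borel_measurable_times_ennreal)
  finally show ?thesis .
qed

definition R_op ::
    "('z \<Rightarrow> 'x \<Rightarrow> real) \<Rightarrow> ('z \<Rightarrow> real) \<Rightarrow> ('z \<Rightarrow> real) \<Rightarrow>
     ('x \<Rightarrow> ('z::topological_space \<Rightarrow>\<^sub>C real) \<Rightarrow> ('z \<Rightarrow>\<^sub>C real)) \<Rightarrow>
     ('z \<Rightarrow> ('x::topological_space \<Rightarrow>\<^sub>C real) \<Rightarrow> ('x \<Rightarrow>\<^sub>C real)) \<Rightarrow>
     (('z \<times> 'x) \<Rightarrow>\<^sub>C real) \<Rightarrow> 'z \<times> 'x \<Rightarrow> real" where
  "R_op m \<sigma> \<alpha> A L \<phi> = (\<lambda>(z, x).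
     \<sigma> z / m z x * apply_bcontfun (A x (z_section \<phi> x)) z +
     \<alpha> z * apply_bcontfun (L z (x_section \<phi> z)) x)"

definition admissible ::
    "((('z::topological_space \<times> 'x::topological_space) \<Rightarrow>\<^sub>C real) \<Rightarrow> real) \<Rightarrow>
     ('x \<Rightarrow> ('z \<Rightarrow>\<^sub>C real) set) \<Rightarrow> ('x \<Rightarrow> ('z \<Rightarrow>\<^sub>C real) \<Rightarrow> ('z \<Rightarrow>\<^sub>C real)) \<Rightarrow>
     ('z \<Rightarrow> ('x \<Rightarrow>\<^sub>C real) set) \<Rightarrow> ('z \<Rightarrow> ('x \<Rightarrow>\<^sub>C real) \<Rightarrow> ('x \<Rightarrow>\<^sub>C real)) \<Rightarrow>
     (('z \<times> 'x) \<Rightarrow>\<^sub>C real) \<Rightarrow> bool" where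
  "admissible N DA A DL L \<phi> \<longleftrightarrow>
     \<phi> \<in> banach_tensor N \<and>
     (\<forall>z. x_section \<phi> z \<in> DL z) \<and>
     (\<forall>x. z_section \<phi> x \<in> DA x) \<and>
     (\<lambda>(z, x). apply_bcontfun (A x (z_section \<phi> x)) z) \<in> borel_measurable borel \<and>
     (\<lambda>(z, x). apply_bcontfun (L z (x_section \<phi> z)) x) \<in> borel_measurable borel"

text \<open>A Bochner integral that does not exist is 0 in HOL; this is harmless in the two a.e.
  conditions below, since the adjacent finiteness conditions force integrability for almost
  every \<open>x\<close>, respectively \<open>z\<close> (as \<open>\<alpha> / \<sigma> > 0\<close> almost everywhere).\<close>

definition balanced ::
    "'z::topological_space measure \<Rightarrow> 'x::topological_space measure \<Rightarrow> ('z \<Rightarrow> 'x measure) \<Rightarrow>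
     ('z \<Rightarrow> real) \<Rightarrow> ('z \<Rightarrow> real) \<Rightarrow>
     ('x \<Rightarrow> ('z \<Rightarrow>\<^sub>C real) \<Rightarrow> ('z \<Rightarrow>\<^sub>C real)) \<Rightarrow> ('z \<Rightarrow> ('x \<Rightarrow>\<^sub>C real) \<Rightarrow> ('x \<Rightarrow>\<^sub>C real)) \<Rightarrow>
     (('z \<times> 'x) \<Rightarrow>\<^sub>C real) \<Rightarrow> bool" where
  "balanced \<upsilon> \<gamma> \<nu> \<sigma> \<alpha> A L \<phi> \<longleftrightarrow>
     (\<integral>\<^sup>+x. (\<integral>\<^sup>+z. ennreal \<bar>apply_bcontfun (A x (z_section \<phi> x)) z\<bar> \<partial>\<upsilon>) \<partial>\<gamma>) < \<infinity> \<and>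
     (AE x in \<gamma>. (\<integral>z. apply_bcontfun (A x (z_section \<phi> x)) z \<partial>\<upsilon>) = 0) \<and>
     (\<integral>\<^sup>+z. ennreal (\<alpha> z / \<sigma> z) *
        (\<integral>\<^sup>+x. ennreal \<bar>apply_bcontfun (L z (x_section \<phi> z)) x\<bar> \<partial>\<nu> z) \<partial>\<upsilon>) < \<infinity> \<and>
     (AE z in \<upsilon>. (\<integral>x. apply_bcontfun (L z (x_section \<phi> z)) x \<partial>\<nu> z) = 0)"

end

theory Submission
  imports Defs
begin

text \<open>Against the density \<open>m / \<sigma>\<close> of \<open>\<kappa>\<close>, the weight \<open>\<sigma> / m\<close> of the first term of \<open>R \<phi>\<close> cancels, so
  that its \<open>\<kappa>\<close>-integral is the \<open>\<upsilon> \<times> \<gamma>\<close>-integral of \<open>A\<^sup>(\<^sup>x\<^sup>) f\<close>, which vanishes upon integrating over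
  \<open>z\<close> first. In the second term \<open>m(z, x) d\<gamma>(x) = d\<nu>\<^sup>(\<^sup>z\<^sup>)(x)\<close>, so that it vanishes upon integrating over
  \<open>x\<close> first. Fubini's theorem applies because a locally finite measure on a locally compact Polish
  space is \<open>\<sigma>\<close>-finite.\<close>

text \<open>Local compactness puts around each point an open set contained in a compact one, hence
  of finite measure. Such sets cover the space, and by second countability (Lindelof) countably many
  of them suffice.\<close>

lemma sigma_finite_locally_finite_borel_measure:
  fixes M :: "'a::polish_space measure"
  assumes "locally compact (UNIV :: 'a set)" and "locally_finite_borel_measure M"
  shows "sigma_finite_measure M"
proof
  have sets: "sets M = sets borel" and fin: "\<And>K. compact K \<Longrightarrow> emeasure M K < \<infinity>"
    using assms(2) by (auto simp: locally_finite_borel_measure_def)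
  define F where "F = {U :: 'a set. open U \<and> (\<exists>K. compact K \<and> U \<subseteq> K)}"
  have "\<exists>U\<in>F. x \<in> U" for x
    using assms(1) unfolding locally_def F_def by (fastforce simp: openin_open)
  then have "\<Union>F = UNIV" by auto
  then obtain F' where F': "F' \<subseteq> F" "countable F'" "\<Union>F' = UNIV"
    using Lindelof[of F] unfolding F_def by (metis (no_types, lifting) mem_Collect_eq)
  have "emeasure M U \<noteq> \<infinity>" if "U \<in> F" for U
  proof -
    from that obtain K where "compact K" "U \<subseteq> K" by (auto simp: F_def)
    then have "emeasure M U \<le> emeasure M K"
      by (intro emeasure_mono) (auto simp: sets borel_compact)
    then show ?thesis using fin[OF \<open>compact K\<close>] by auto
  qed
  then have "\<forall>U\<in>F'. emeasure M U \<noteq> \<infinity>"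
    using F'(1) by blast
  moreover have "F' \<subseteq> sets M"
    using F'(1) sets by (auto simp: F_def)
  ultimately show "\<exists>A. countable A \<and> A \<subseteq> sets M \<and> \<Union>A = space M \<and> (\<forall>a\<in>A. emeasure M a \<noteq> \<infinity>)"
    using F'(2,3) sets_eq_imp_space_eq[OF sets] by (intro exI[of _ F']) auto
qed

text \<open>Tonelli turns the finite iterated integral of the absolute value into integrability on
  the product; Fubini then evaluates the integral in the same order. This order serves the
  \<open>L\<close> term, where the inner integral runs over the second coordinate.\<close>

lemma (in pair_sigma_finite) has_bochner_integral_zero_fst:
  fixes f :: "'a \<Rightarrow> 'b \<Rightarrow> real"
  assumes [measurable]: "case_prod f \<in> borel_measurable (M1 \<Otimes>\<^sub>M M2)"
    and "(\<integral>\<^sup>+x. (\<integral>\<^sup>+y. ennreal \<bar>f x y\<bar> \<partial>M2) \<partial>M1) < \<infinity>"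
    and "AE x in M1. (\<integral>y. f x y \<partial>M2) = 0"
  shows "has_bochner_integral (M1 \<Otimes>\<^sub>M M2) (case_prod f) 0"
proof -
  have "(\<integral>\<^sup>+p. ennreal (norm (case_prod f p)) \<partial>(M1 \<Otimes>\<^sub>M M2)) < \<infinity>"
    using assms(2) by (subst M2.nn_integral_fst[symmetric]) (auto simp: real_norm_def)
  then have i: "integrable (M1 \<Otimes>\<^sub>M M2) (case_prod f)"
    by (intro integrableI_bounded) auto
  have "integral\<^sup>L (M1 \<Otimes>\<^sub>M M2) (case_prod f) = (\<integral>x. (\<integral>y. f x y \<partial>M2) \<partial>M1)"
    using integral_fst[OF i] by simp
  also have "\<dots> = 0"
    using assms(3) by (rule integral_eq_zero_AE)
  finally show ?thesis using i by (simp add: has_bochner_integral_iff)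
qed

text \<open>The mirror image, for the \<open>A\<close> term: there \<open>balanced\<close>
  integrates over the first coordinate innermost.\<close>

lemma (in pair_sigma_finite) has_bochner_integral_zero_snd:
  fixes f :: "'a \<Rightarrow> 'b \<Rightarrow> real"
  assumes [measurable]: "case_prod f \<in> borel_measurable (M1 \<Otimes>\<^sub>M M2)"
    and "(\<integral>\<^sup>+y. (\<integral>\<^sup>+x. ennreal \<bar>f x y\<bar> \<partial>M1) \<partial>M2) < \<infinity>"
    and "AE y in M2. (\<integral>x. f x y \<partial>M1) = 0"
  shows "has_bochner_integral (M1 \<Otimes>\<^sub>M M2) (case_prod f) 0"
proof -
  have "(\<integral>\<^sup>+p. ennreal (norm (case_prod f p)) \<partial>(M1 \<Otimes>\<^sub>M M2)) < \<infinity>"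
    using assms(2) by (subst nn_integral_snd[symmetric]) (auto simp: real_norm_def)
  then have i: "integrable (M1 \<Otimes>\<^sub>M M2) (case_prod f)"
    by (intro integrableI_bounded) auto
  have "integral\<^sup>L (M1 \<Otimes>\<^sub>M M2) (case_prod f) = (\<integral>y. (\<integral>x. f x y \<partial>M1) \<partial>M2)"
    using integral_snd[OF i] by simp
  also have "\<dots> = 0"
    using assms(3) by (rule integral_eq_zero_AE)
  finally show ?thesis using i by (simp add: has_bochner_integral_iff)
qed

text \<open>A finite factor is the \<open>ennreal\<close> of a real number, so that scaling becomes
  a constant density and the rule for integrals against a density applies.\<close>

lemma has_bochner_integral_scale_measure:
  fixes f :: "'a \<Rightarrow> 'b::{banach, second_countable_topology}"
  assumes "r < \<infinity>" and f: "has_bochner_integral M f x"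
  shows "has_bochner_integral (scale_measure r M) f (enn2real r *\<^sub>R x)"
proof -
  have "scale_measure r M = density M (\<lambda>_. ennreal (enn2real r))"
    using assms(1) by (intro measure_eqI) (auto simp: emeasure_density_const)
  then show ?thesis
    using has_bochner_integral_scaleR_right[OF f, of "enn2real r"] f
    by (auto intro!: has_bochner_integral_density dest: borel_measurable_has_bochner_integral)
qed

lemma sets_kappa:
  fixes \<upsilon> :: "'z::polish_space measure" and \<gamma> :: "'x::polish_space measure"
  assumes "sets \<upsilon> = sets borel" and "sets \<gamma> = sets borel"
  shows "sets (kappa \<upsilon> \<gamma> m \<sigma>) = sets borel"
  using assms by (simp add: kappa_def borel_prod[symmetric] cong: sets_pair_measure_cong)

text \<open>Cancelling \<sigma> and \<open>m\<close> requires both to be positive at almost every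
  point of the product; for \<sigma> this is known only in the first coordinate and is lifted
  here.\<close>

lemma kappa_density_pos:
  fixes \<upsilon> :: "'z::polish_space measure" and \<gamma> :: "'x::polish_space measure"
    and m :: "'z \<Rightarrow> 'x \<Rightarrow> real" and \<sigma> :: "'z \<Rightarrow> real"
  assumes "pair_sigma_finite \<upsilon> \<gamma>"
    and s: "sets \<upsilon> = sets borel" "sets \<gamma> = sets borel"
    and "\<sigma> \<in> borel_measurable borel" and "AE z in \<upsilon>. 0 < \<sigma> z"
    and "AE (z, x) in \<upsilon> \<Otimes>\<^sub>M \<gamma>. 0 < m z x"
  shows "AE (z, x) in \<upsilon> \<Otimes>\<^sub>M \<gamma>. 0 < m z x \<and> 0 < \<sigma> z"
proof -
  interpret pair_sigma_finite \<upsilon> \<gamma> by fact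
  have [measurable]: "\<sigma> \<in> borel_measurable \<upsilon>"
    using assms(4) by (simp add: measurable_cong_sets[OF s(1) refl])
  have "AE p in \<upsilon> \<Otimes>\<^sub>M \<gamma>. 0 < \<sigma> (fst p)"
  proof (rule AE_pair_measure)
    show "{p \<in> space (\<upsilon> \<Otimes>\<^sub>M \<gamma>). 0 < \<sigma> (fst p)} \<in> sets (\<upsilon> \<Otimes>\<^sub>M \<gamma>)" by measurable
    show "AE z in \<upsilon>. AE x in \<gamma>. 0 < \<sigma> (fst (z, x))"
      using assms(5) by eventually_elim simp
  qed
  with assms(6) show ?thesis by eventually_elim auto
qed

text \<open>Needed for dividing by \<Xi>. If \<kappa> had mass zero, its density would vanish almost
  everywhere; as it is also positive almost everywhere, the product measure would be null, although
  its mass is the product of two nonzero masses.\<close>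

lemma emeasure_kappa_neq_0:
  fixes \<upsilon> :: "'z::polish_space measure" and \<gamma> :: "'x::polish_space measure"
  assumes "pair_sigma_finite \<upsilon> \<gamma>"
    and s: "sets \<upsilon> = sets borel" "sets \<gamma> = sets borel"
    and "(\<lambda>(z, x). m z x) \<in> borel_measurable borel" and "\<sigma> \<in> borel_measurable borel"
    and pos: "AE (z, x) in \<upsilon> \<Otimes>\<^sub>M \<gamma>. 0 < m z x \<and> 0 < \<sigma> z"
    and "emeasure \<upsilon> UNIV \<noteq> 0" and "emeasure \<gamma> UNIV \<noteq> 0"
  shows "emeasure (kappa \<upsilon> \<gamma> m \<sigma>) UNIV \<noteq> 0"
proof
  interpret pair_sigma_finite \<upsilon> \<gamma> by fact
  let ?P = "\<upsilon> \<Otimes>\<^sub>M \<gamma>"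
  have p: "sets ?P = sets (borel :: ('z \<times> 'x) measure)"
    using s by (simp add: borel_prod[symmetric] cong: sets_pair_measure_cong)
  have sp: "space ?P = UNIV" using sets_eq_imp_space_eq[OF p] by simp
  have [measurable]: "(\<lambda>(z, x). m z x) \<in> borel_measurable ?P" "\<sigma> \<in> borel_measurable \<upsilon>"
    using assms(4,5) by (simp_all add: measurable_cong_sets[OF p refl] measurable_cong_sets[OF s(1) refl])
  have d: "(\<lambda>(z, x). ennreal (m z x / \<sigma> z)) \<in> borel_measurable ?P"
    unfolding case_prod_beta by measurable
  assume "emeasure (kappa \<upsilon> \<gamma> m \<sigma>) UNIV = 0"
  then have "(\<integral>\<^sup>+q. (\<lambda>(z, x). ennreal (m z x / \<sigma> z)) q \<partial>?P) = 0"
    using d sp by (simp add: kappa_def emeasure_density sets.top[of ?P, unfolded sp])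
  then have "AE q in ?P. (\<lambda>(z, x). ennreal (m z x / \<sigma> z)) q = 0"
    using d by (simp add: nn_integral_0_iff_AE)
  with pos have "AE q in ?P. False"
    by eventually_elim (auto simp: ennreal_eq_0_iff divide_le_0_iff)
  then have "emeasure ?P (space ?P) = 0"
    by (simp add: AE_iff_measurable[OF _ refl])
  moreover have "space ?P = UNIV \<times> UNIV" using sp by simp
  ultimately have "emeasure \<upsilon> UNIV * emeasure \<gamma> UNIV = 0"
    using M2.emeasure_pair_measure_Times[of UNIV \<upsilon> UNIV] s by simp
  with assms(7,8) show False by simp
qed

lemma has_bochner_integral_R_op:
  fixes \<upsilon> :: "'z::polish_space measure" and \<gamma> :: "'x::polish_space measure"
  assumes "pair_sigma_finite \<upsilon> \<gamma>"
    and s: "sets \<upsilon> = sets borel" "sets \<gamma> = sets borel"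
    and m: "(\<lambda>(z, x). m z x) \<in> borel_measurable borel" and m0: "\<And>z x. 0 \<le> m z x"
    and \<nu>: "\<And>z. \<nu> z = density \<gamma> (\<lambda>x. ennreal (m z x))"
    and \<sigma>: "\<sigma> \<in> borel_measurable borel" "AE z in \<upsilon>. 0 < \<sigma> z"
    and pos: "AE (z, x) in \<upsilon> \<Otimes>\<^sub>M \<gamma>. 0 < m z x \<and> 0 < \<sigma> z"
    and \<alpha>: "\<alpha> \<in> borel_measurable borel" "\<And>z. 0 < \<alpha> z"
    and adm: "admissible N DA A DL L \<phi>" and bal: "balanced \<upsilon> \<gamma> \<nu> \<sigma> \<alpha> A L \<phi>"
  shows "has_bochner_integral (kappa \<upsilon> \<gamma> m \<sigma>) (R_op m \<sigma> \<alpha> A L \<phi>) 0"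
proof -
  interpret pair_sigma_finite \<upsilon> \<gamma> by fact
  let ?P = "\<upsilon> \<Otimes>\<^sub>M \<gamma>"
  define F where "F z x = apply_bcontfun (A x (z_section \<phi> x)) z" for z x
  define G where "G z x = apply_bcontfun (L z (x_section \<phi> z)) x" for z x
  \<comment> \<open>This is the second term of \<open>R_op\<close> times the density of \<kappa>,
    grouped so that the weight \<open>\<alpha> z / \<sigma> z\<close> of \<open>balanced\<close>
    stands in front.\<close>
  define H where "H z x = \<alpha> z / \<sigma> z * (m z x * G z x)" for z x
  have p: "sets ?P = sets (borel :: ('z \<times> 'x) measure)"
    using s by (simp add: borel_prod[symmetric] cong: sets_pair_measure_cong)
  have [measurable]: "case_prod m \<in> borel_measurable ?P" "case_prod F \<in> borel_measurable ?P"
      "case_prod G \<in> borel_measurable ?P" "\<sigma> \<in> borel_measurable \<upsilon>" "\<alpha> \<in> borel_measurable \<upsilon>"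
    using m adm \<sigma>(1) \<alpha>(1) unfolding F_def G_def admissible_def
    by (simp_all add: measurable_cong_sets[OF p refl] measurable_cong_sets[OF s(1) refl])
  have mz [measurable]: "m z \<in> borel_measurable \<gamma>" and Gz [measurable]: "G z \<in> borel_measurable \<gamma>"
    if "z \<in> space \<upsilon>" for z
    using that measurable_Pair2[of "case_prod m" \<upsilon> \<gamma> borel z]
      measurable_Pair2[of "case_prod G" \<upsilon> \<gamma> borel z] by auto
  have F: "has_bochner_integral ?P (case_prod F) 0"
    using bal unfolding balanced_def F_def[symmetric]
    by (intro has_bochner_integral_zero_snd) auto
  \<comment> \<open>Only almost everywhere: where \<sigma> is negative, \<open>ennreal\<close>
    truncates the weight to 0, whereas the absolute value of \<open>H\<close> retains it.\<close>
  have "AE z in \<upsilon>. (\<integral>\<^sup>+x. ennreal \<bar>H z x\<bar> \<partial>\<gamma>) = ennreal (\<alpha> z / \<sigma> z) * (\<integral>\<^sup>+x. ennreal \<bar>G z x\<bar> \<partial>\<nu> z)"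
    using \<sigma>(2) AE_space
  proof eventually_elim
    case (elim z)
    note [measurable] = mz[OF elim(2)] Gz[OF elim(2)]
    have "ennreal \<bar>H z x\<bar> = ennreal (\<alpha> z / \<sigma> z) * (ennreal (m z x) * ennreal \<bar>G z x\<bar>)" for x
      using elim m0[of z x] \<alpha>(2)[of z]
      by (simp add: H_def abs_mult ennreal_mult[symmetric])
    then show ?case by (simp add: \<nu> nn_integral_cmult nn_integral_density)
  qed
  then have H1: "(\<integral>\<^sup>+z. (\<integral>\<^sup>+x. ennreal \<bar>H z x\<bar> \<partial>\<gamma>) \<partial>\<upsilon>) < \<infinity>"
    using bal unfolding balanced_def G_def[symmetric] by (simp cong: nn_integral_cong_AE)
  have "AE z in \<upsilon>. (\<integral>x. G z x \<partial>\<nu> z) = 0"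
    using bal unfolding balanced_def G_def by blast
  then have H2: "AE z in \<upsilon>. (\<integral>x. H z x \<partial>\<gamma>) = 0"
    using AE_space
  proof eventually_elim
    case (elim z)
    \<comment> \<open>The density of \<open>\<nu> z\<close> is absorbed into the integrand, which
      turns the vanishing \<nu>-integral of \<open>G\<close> into one against \<gamma>.\<close>
    have "(\<integral>x. m z x * G z x \<partial>\<gamma>) = 0"
      using elim m0 by (simp add: \<nu> integral_density mz Gz)
    then show ?case by (simp add: H_def)
  qed
  have "case_prod H \<in> borel_measurable ?P"
    unfolding H_def case_prod_beta by measurable
  then have H: "has_bochner_integral ?P (case_prod H) 0"
    using H1 H2 by (rule has_bochner_integral_zero_fst)
  define d where "d = (\<lambda>(z, x). m z x / \<sigma> z)"
  have R: "R_op m \<sigma> \<alpha> A L \<phi> = (\<lambda>(z, x). \<sigma> z / m z x * F z x + \<alpha> z * G z x)"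
    by (simp add: R_op_def F_def G_def)
  have Rm: "R_op m \<sigma> \<alpha> A L \<phi> \<in> borel_measurable ?P"
    unfolding R case_prod_beta by measurable
  have dm: "d \<in> borel_measurable ?P" unfolding d_def case_prod_beta by measurable
  \<comment> \<open>Where \<open>m\<close> and \<sigma> are positive, \<open>m / \<sigma>\<close>
    times \<open>\<sigma> / m\<close> is 1. At points with \<open>m z x = 0\<close> the left side is
    0 by the convention for division, so the identity can fail on a null set.\<close>
  have "AE q in ?P. d q *\<^sub>R R_op m \<sigma> \<alpha> A L \<phi> q = case_prod F q + case_prod H q"
    using pos by eventually_elim (auto simp: R H_def d_def field_simps)
  moreover have "has_bochner_integral ?P (\<lambda>q. case_prod F q + case_prod H q) 0"
    using has_bochner_integral_add[OF F H] by simp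
  ultimately have "has_bochner_integral ?P (\<lambda>q. d q *\<^sub>R R_op m \<sigma> \<alpha> A L \<phi> q) 0"
    using Rm dm by (subst has_bochner_integral_cong_AE) auto
  moreover have "AE q in ?P. 0 \<le> d q"
    using pos by eventually_elim (auto simp: d_def)
  ultimately have "has_bochner_integral (density ?P (\<lambda>q. ennreal (d q))) (R_op m \<sigma> \<alpha> A L \<phi>) 0"
    using Rm dm by (intro has_bochner_integral_density)
  moreover have "kappa \<upsilon> \<gamma> m \<sigma> = density ?P (\<lambda>q. ennreal (d q))"
    by (simp add: kappa_def d_def split_beta')
  ultimately show ?thesis by simp
qed

theorem theorem4p2:
  fixes \<upsilon> :: "'z::polish_space measure"
    and \<gamma> :: "'x::polish_space measure"
    and \<nu> :: "'z \<Rightarrow> 'x measure"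
    and m :: "'z \<Rightarrow> 'x \<Rightarrow> real"
    and \<sigma> \<alpha> :: "'z \<Rightarrow> real"
    and DL :: "'z \<Rightarrow> ('x \<Rightarrow>\<^sub>C real) set"
    and L :: "'z \<Rightarrow> ('x \<Rightarrow>\<^sub>C real) \<Rightarrow> ('x \<Rightarrow>\<^sub>C real)"
    and DA :: "'x \<Rightarrow> ('z \<Rightarrow>\<^sub>C real) set"
    and A :: "'x \<Rightarrow> ('z \<Rightarrow>\<^sub>C real) \<Rightarrow> ('z \<Rightarrow>\<^sub>C real)"
    and N :: "(('z \<times> 'x) \<Rightarrow>\<^sub>C real) \<Rightarrow> real"
  assumes "locally compact (UNIV :: 'z set)" and "locally compact (UNIV :: 'x set)"
    and "locally_finite_borel_measure \<upsilon>" and "emeasure \<upsilon> UNIV \<noteq> 0"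
    and "locally_finite_borel_measure \<gamma>" and "emeasure \<gamma> UNIV \<noteq> 0"
    and "\<And>z. locally_finite_borel_measure (\<nu> z)"
    and "(\<lambda>(z, x). m z x) \<in> borel_measurable borel" and "\<And>z x. 0 \<le> m z x"
    and "\<And>z. \<nu> z = density \<gamma> (\<lambda>x. ennreal (m z x))"
    and "AE (z, x) in \<upsilon> \<Otimes>\<^sub>M \<gamma>. 0 < m z x"
    and "\<And>z. feller_generator (DL z) (L z)" and "\<And>z. core_invariant (\<nu> z) (DL z) (L z)"
    and "\<And>x. feller_generator (DA x) (A x)" and "\<And>x. core_invariant \<upsilon> (DA x) (A x)"
    and "\<sigma> \<in> borel_measurable borel" and "AE z in \<upsilon>. 0 < \<sigma> z"
    and "\<alpha> \<in> borel_measurable borel" and "\<And>z. 0 < \<alpha> z"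
    and "reasonable_cross_norm N"
  shows "(\<forall>\<phi>. admissible N DA A DL L \<phi> \<longrightarrow> balanced \<upsilon> \<gamma> \<nu> \<sigma> \<alpha> A L \<phi> \<longrightarrow>
           has_bochner_integral (kappa \<upsilon> \<gamma> m \<sigma>) (R_op m \<sigma> \<alpha> A L \<phi>) 0)
       \<and>
         (let \<Xi> = emeasure (kappa \<upsilon> \<gamma> m \<sigma>) UNIV;
             \<pi> = scale_measure (1 / \<Xi>) (kappa \<upsilon> \<gamma> m \<sigma>)
         in \<Xi> < \<infinity> \<longrightarrow>
              prob_space \<pi> \<and> sets \<pi> = sets borel \<and>
              (\<forall>\<phi>. admissible N DA A DL L \<phi> \<longrightarrow> balanced \<upsilon> \<gamma> \<nu> \<sigma> \<alpha> A L \<phi> \<longrightarrow>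
                 has_bochner_integral \<pi> (R_op m \<sigma> \<alpha> A L \<phi>) 0))"
proof -
  have s: "sets \<upsilon> = sets borel" "sets \<gamma> = sets borel"
    using assms(3,5) by (auto simp: locally_finite_borel_measure_def)
  interpret \<upsilon>: sigma_finite_measure \<upsilon>
    by (rule sigma_finite_locally_finite_borel_measure) fact+
  interpret \<gamma>: sigma_finite_measure \<gamma>
    by (rule sigma_finite_locally_finite_borel_measure) fact+
  have P: "pair_sigma_finite \<upsilon> \<gamma>" by unfold_locales
  let ?K = "kappa \<upsilon> \<gamma> m \<sigma>"
  have K: "sets ?K = sets borel" using s by (rule sets_kappa)
  have pos: "AE (z, x) in \<upsilon> \<Otimes>\<^sub>M \<gamma>. 0 < m z x \<and> 0 < \<sigma> z"
    by (rule kappa_density_pos[OF P s]) fact+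
  have I: "has_bochner_integral ?K (R_op m \<sigma> \<alpha> A L \<phi>) 0"
    if "admissible N DA A DL L \<phi>" "balanced \<upsilon> \<gamma> \<nu> \<sigma> \<alpha> A L \<phi>" for \<phi>
    by (rule has_bochner_integral_R_op[OF P s assms(8-10,16,17) pos assms(18,19) that])
  have nz: "emeasure ?K UNIV \<noteq> 0"
    by (rule emeasure_kappa_neq_0[OF P s assms(8,16) pos assms(4,6)])
  have "prob_space (scale_measure (1 / emeasure ?K UNIV) ?K)" if "emeasure ?K UNIV < \<infinity>"
    using that nz sets_eq_imp_space_eq[OF K]
    by (intro prob_spaceI) (simp add: space_scale_measure ennreal_divide_times ennreal_divide_self)
  \<comment> \<open>In \<open>ennreal\<close> the quotient \<open>1 / 0\<close> is infinite, so
    finiteness of the scaling factor rests on \<Xi> being nonzero.\<close>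
  moreover have "1 / emeasure ?K UNIV < \<infinity>"
    using nz by (simp add: ennreal_divide_eq_top_iff less_top[symmetric])
  \<comment> \<open>Under \<pi> the integral is the one under \<kappa> times the finite factor
    \<open>1 / \<Xi>\<close>, hence again 0.\<close>
  ultimately show ?thesis
    using I K has_bochner_integral_scale_measure[of "1 / emeasure ?K UNIV" ?K _ "0::real"]
    by (auto simp: Let_def)
qed

end
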